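(* Let $q_0$ be a probability density on $\mathbb{R}^d$ (the base distribution), let $q_f$ be an (unknown) probability density on $\mathbb{R}^d$ (the forget distribution), and let $F:\mathbb{R}^d\to\mathbb{R}$ be an energy function for $q_f$, i.e. $F(x)\propto -\log q_f(x)$. Let $\lambda>0$, let $\sigma(z)=\frac{1}{1+e^{-z}}$ be the sigmoid function, and define the reweighted target density $$\tilde q_1(x)=\frac{1}{Z}\,q_0(x)\,\sigma(-\lambda F(x)),\qquad Z=\int_{\mathbb{R}^d} q_0(x)\,\sigma(-\lambda F(x))\,dx .$$ Let $v_\theta:[0,1]\times\mathbb{R}^d\to\mathbb{R}^d$ be a velocity field with parameter $\theta$, and define the Energy-Reweighted Flow Matching loss $$\mathcal{L}_{\mathrm{ERFM}}(\theta)=\mathbb{E}_{x_0,x_1\sim q_0,\; t\sim\mathcal{U}[0,1],\; x\sim p_t(x\mid x_0,x_1)}\Big[\sigma(-\lambda F(x_1))\,\big\|v_\theta(t,x)-u_t(x\mid x_0,x_1)\big\|^2\Big],$$ where $x_0,x_1$ are independent, and $p_t(\cdot\mid x_0,x_1)$ and $u_t(\cdot\mid x_0,x_1)$ are the Gaussian conditional path and target velocity of Conditional Flow Matching. Let $\mathcal{L}_{\mathrm{CFM}}^{q_0\to\tilde q_1}(\theta)$ be the Conditional Flow Matching loss from $q_0$ to $\tilde q_1$. Then there is a constant $C>0$, independent of $\theta$, such that $$\nabla_\theta\mathcal{L}_{\mathrm{ERFM}}(\theta)=C\cdot\nabla_\theta\mathcal{L}_{\mathrm{CFM}}^{q_0\to\tilde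 q_1}(\theta)$$ for all $\theta$ at which these losses are finite and differentiable.
   Context: Energy functions: a (measurable) function $F:\mathbb{R}^d\to\mathbb{R}$ is an energy function for a density $p$ when it represents $-\log p$ in unnormalized form, written $F(x)\propto-\log p(x)$; in the Boltzmann representation, $p(x)=e^{-F(x)}/\int e^{-F(y)}\,dy$. Conditional Flow Matching (CFM): fix a noise level $s>0$. For $x_0,x_1\in\mathbb{R}^d$ and $t\in[0,1]$ set $\psi_t(x_0,x_1)=(1-t)x_0+t x_1$ (interpolation path), $p_t(x\mid x_0,x_1)=\mathcal{N}(x\mid\psi_t(x_0,x_1),s^2 I)$, the Gaussian density with mean $\psi_t(x_0,x_1)$ and covariance $s^2I$ (conditional distribution), $u_t(x\mid x_0,x_1)=x_1-x_0$ (target velocity). For a source density $p_0$ and a target density $p_1$ on $\mathbb{R}^d$, and a parametrized (neural) measurable velocity field $v_\theta:[0,1]\times\mathbb{R}^d\to\mathbb{R}^d$ with $\theta$ in a finite-dimensional Euclidean parameter space, the CFM loss from $p_0$ to $p_1$ is $$\mathcal{L}_{\mathrm{CFM}}^{p_0\to p_1}(\theta)=\mathbb{E}_{t\sim\mathcal{U}[0,1],\;(x_0,x_1)\sim p_0\times p_1,\;x\sim p_t(x\mid x_0,x_1)}\Big[\big\|v_\theta(t,x)-u_t(x\mid x_0,x_1)\big\|^2\Big],$$ where $t$ is independent of $(x_0,x_1)$ and $p_0\times p_1$ is the product (independent) coupling. In both losses $t$ is uniform on $[0,1]$ and independent of $(x_0,x_1)$, and $\|\cdot\|$ is the Euclidean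 norm. *)

theory Defs
  imports "HOL-Probability.Probability"
begin

definition sigmoid :: "real \<Rightarrow> real" where
  "sigmoid z = 1 / (1 + exp (- z))"

text \<open>The gradient operator belonging to the library's relation \<open>GDERIV\<close>;
  meaningful only where the function is differentiable.\<close>

definition gradient :: "('p::euclidean_space \<Rightarrow> real) \<Rightarrow> 'p \<Rightarrow> 'p" where
  "gradient f x = (THE D. GDERIV f x :> D)"

lemma gradient_eq:
  assumes "GDERIV f x :> D"
  shows "gradient f x = D"
  unfolding gradient_def
proof (rule the_equality)
  fix E assume "GDERIV f x :> E"
  then have "(\<lambda>h. h \<bullet> E) = (\<lambda>h. h \<bullet> D)"
    using assms unfolding gderiv_def by (rule has_derivative_unique)
  then have "h \<bullet> E = h \<bullet> D" for h
    by (rule fun_cong)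
  then show "E = D"
    by (metis inner_commute vector_eq_ldot)
qed (fact assms)

lemma GDERIV_gradient:
  assumes "f differentiable (at x)"
  shows "GDERIV f x :> gradient f x"
proof -
  obtain f' where f': "(f has_derivative f') (at x)"
    using assms unfolding differentiable_def by blast
  then interpret bounded_linear f'
    by (rule has_derivative_bounded_linear)
  have "f' = (\<lambda>h. h \<bullet> adjoint f' 1)"
    using adjoint_works[OF linear_axioms, of _ 1] by (simp add: fun_eq_iff inner_commute)
  with f' have "GDERIV f x :> adjoint f' 1"
    unfolding gderiv_def by simp
  then show ?thesis
    by (simp only: gradient_eq)
qed

definition prob_density :: "(real ^ 'd \<Rightarrow> real) \<Rightarrow> bool" where
  "prob_density p \<longleftrightarrow>
     p \<in> borel_measurable borel \<and> (\<forall>x. 0 \<le> p x) \<and> (\<integral>\<^sup>+x. ennreal (p x) \<partial>lborel) = 1"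

text \<open>\<open>F\<close> is \<open>- log p\<close> up to an additive constant, in the Boltzmann form. As densities
  are determined only up to null sets, the identity is required almost everywhere.\<close>

definition energy_function :: "(real ^ 'd \<Rightarrow> real) \<Rightarrow> (real ^ 'd \<Rightarrow> real) \<Rightarrow> bool" where
  "energy_function F p \<longleftrightarrow>
     F \<in> borel_measurable borel \<and>
     integrable lborel (\<lambda>y. exp (- F y)) \<and>
     (AE x in lborel. p x = exp (- F x) / (\<integral>y. exp (- F y) \<partial>lborel))"

definition interp_path :: "real \<Rightarrow> real ^ 'd \<Rightarrow> real ^ 'd \<Rightarrow> real ^ 'd" where
  "interp_path t x0 x1 = (1 - t) *\<^sub>R x0 + t *\<^sub>R x1"

text \<open>Here \<open>s\<close> is the standard deviation: the covariance matrix is \<open>s\<^sup>2 I\<close>.\<close>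

definition gaussian_density :: "real ^ 'd \<Rightarrow> real \<Rightarrow> real ^ 'd \<Rightarrow> real" where
  "gaussian_density m s x =
     1 / sqrt (2 * pi * s\<^sup>2) ^ CARD('d) * exp (- (norm (x - m))\<^sup>2 / (2 * s\<^sup>2))"

lemma gaussian_density_eq_prod:
  "gaussian_density m s x = (\<Prod>i\<in>UNIV. normal_density (m $ i) s (x $ i))"
  by (simp add: gaussian_density_def normal_density_def prod.distrib prod_dividef
      norm_vec_def L2_set_def real_sqrt_pow2 sum_nonneg exp_sum[symmetric]
      sum_negf[symmetric] sum_divide_distrib)

definition cond_path_density ::
    "real \<Rightarrow> real \<Rightarrow> real ^ 'd \<Rightarrow> real ^ 'd \<Rightarrow> real ^ 'd \<Rightarrow> real" where
  "cond_path_density s t x0 x1 x = gaussian_density (interp_path t x0 x1) s x"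

definition target_velocity ::
    "real \<Rightarrow> real ^ 'd \<Rightarrow> real ^ 'd \<Rightarrow> real ^ 'd \<Rightarrow> real ^ 'd" where
  "target_velocity t x0 x1 x = x1 - x0"

text \<open>The expectation of a nonnegative \<open>g t x0 x1 x\<close> for \<open>t\<close>, \<open>x0\<close>, \<open>x1\<close> independent with
  laws uniform on \<open>[0,1]\<close>, \<open>p0\<close>, \<open>p1\<close>, and \<open>x\<close> drawn from the conditional path given
  \<open>(t, x0, x1)\<close>. It is \<open>\<infinity>\<close> exactly when the expectation diverges.\<close>

definition flow_expectation ::
    "real \<Rightarrow> (real ^ 'd \<Rightarrow> real) \<Rightarrow> (real ^ 'd \<Rightarrow> real) \<Rightarrow>
     (real \<Rightarrow> real ^ 'd \<Rightarrow> real ^ 'd \<Rightarrow> real ^ 'd \<Rightarrow> real) \<Rightarrow> ennreal" where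
  "flow_expectation s p0 p1 g =
     (\<integral>\<^sup>+(t, x0, x1).
        (\<integral>\<^sup>+x. ennreal (g t x0 x1 x)
           \<partial>density lborel (\<lambda>x. ennreal (cond_path_density s t x0 x1 x)))
      \<partial>(uniform_measure lborel {0..1} \<Otimes>\<^sub>M
          (density lborel (\<lambda>x. ennreal (p0 x)) \<Otimes>\<^sub>M density lborel (\<lambda>x. ennreal (p1 x)))))"

definition cfm_loss ::
    "real \<Rightarrow> ('p \<Rightarrow> real \<Rightarrow> real ^ 'd \<Rightarrow> real ^ 'd) \<Rightarrow>
     (real ^ 'd \<Rightarrow> real) \<Rightarrow> (real ^ 'd \<Rightarrow> real) \<Rightarrow> 'p \<Rightarrow> ennreal" where
  "cfm_loss s v p0 p1 \<theta> =
     flow_expectation s p0 p1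
       (\<lambda>t x0 x1 x. (norm (v \<theta> t x - target_velocity t x0 x1 x))\<^sup>2)"

definition erfm_loss ::
    "real \<Rightarrow> ('p \<Rightarrow> real \<Rightarrow> real ^ 'd \<Rightarrow> real ^ 'd) \<Rightarrow>
     (real ^ 'd \<Rightarrow> real) \<Rightarrow> (real ^ 'd \<Rightarrow> real) \<Rightarrow> real \<Rightarrow> 'p \<Rightarrow> ennreal" where
  "erfm_loss s v q0 F l \<theta> =
     flow_expectation s q0 q0
       (\<lambda>t x0 x1 x. sigmoid (- l * F x1) * (norm (v \<theta> t x - target_velocity t x0 x1 x))\<^sup>2)"

definition reweighting_constant ::
    "(real ^ 'd \<Rightarrow> real) \<Rightarrow> (real ^ 'd \<Rightarrow> real) \<Rightarrow> real \<Rightarrow> real" where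
  "reweighting_constant q0 F l = (\<integral>x. q0 x * sigmoid (- l * F x) \<partial>lborel)"

definition reweighted_density ::
    "(real ^ 'd \<Rightarrow> real) \<Rightarrow> (real ^ 'd \<Rightarrow> real) \<Rightarrow> real \<Rightarrow> real ^ 'd \<Rightarrow> real" where
  "reweighted_density q0 F l x =
     1 / reweighting_constant q0 F l * (q0 x * sigmoid (- l * F x))"

end

theory Submission
  imports Defs
begin

text \<open>The ERFM loss is \<open>Z\<close> times the CFM loss: multiplying the integrand by
  \<open>\<sigma>(- \<lambda> F(x\<^sub>1))\<close> amounts to replacing the law \<open>q\<^sub>0\<close> of \<open>x\<^sub>1\<close> by its reweighting, up to
  the normalisation \<open>Z\<close>. As \<open>Z > 0\<close> does not depend on the parameter, the gradients are
  proportional with \<open>C = Z\<close>.\<close>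

text \<open>Differentiability makes \<open>gradient f x\<close> a genuine gradient rather than an
  unspecified \<open>THE\<close> value; scaling the derivative \<open>h \<bullet> D\<close> by
  \<open>c\<close> gives the functional represented by \<open>c *\<^sub>R D\<close>.\<close>

lemma gradient_cmult:
  fixes f :: "'p::euclidean_space \<Rightarrow> real"
  assumes "f differentiable (at x)"
  shows "gradient (\<lambda>y. c * f y) x = c *\<^sub>R gradient f x"
proof (rule gradient_eq)
  have "(f has_derivative (\<lambda>h. h \<bullet> gradient f x)) (at x)"
    using GDERIV_gradient[OF assms] by (simp add: gderiv_def)
  from has_derivative_mult_right[OF this, of c]
  show "GDERIV (\<lambda>y. c * f y) x :> c *\<^sub>R gradient f x"
    by (simp add: gderiv_def)
qed

lemma sigmoid_pos: "0 < sigmoid z" and sigmoid_le_1: "sigmoid z \<le> 1"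
  by (simp_all add: sigmoid_def add_pos_pos)

lemma borel_measurable_sigmoid [measurable]: "sigmoid \<in> borel_measurable borel"
  unfolding sigmoid_def[abs_def] by measurable

text \<open>The integrand lies between 0 and \<open>q\<close>, so it is integrable and the integral
  is a true one. Were it zero, the nowhere vanishing sigmoid would force \<open>q = 0\<close> almost
  everywhere, against total mass 1.\<close>

lemma reweighting_constant_pos:
  assumes "prob_density q" and [measurable]: "F \<in> borel_measurable borel"
  shows "0 < reweighting_constant q F l"
proof -
  have [measurable]: "q \<in> borel_measurable borel" and nonneg: "\<And>x. 0 \<le> q x"
    and total: "(\<integral>\<^sup>+x. ennreal (q x) \<partial>lborel) = 1"
    using assms by (auto simp: prob_density_def)
  have int: "integrable lborel q"
    using total nonneg by (intro integrableI_nonneg) auto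
  have int': "integrable lborel (\<lambda>x. q x * sigmoid (- l * F x))"
  proof (rule Bochner_Integration.integrable_bound[OF int])
    show "AE x in lborel. norm (q x * sigmoid (- l * F x)) \<le> norm (q x)"
      using nonneg sigmoid_pos sigmoid_le_1
      by (auto simp: abs_mult less_imp_le intro!: mult_left_le)
  qed measurable
  have "reweighting_constant q F l \<noteq> 0"
  proof
    assume "reweighting_constant q F l = 0"
    then have "AE x in lborel. q x * sigmoid (- l * F x) = 0"
      unfolding reweighting_constant_def
      using integral_nonneg_eq_0_iff_AE[OF int'] nonneg sigmoid_pos
      by (auto simp: less_imp_le)
    then have "AE x in lborel. ennreal (q x) = 0"
      by eventually_elim (metis ennreal_0 mult_eq_0_iff less_irrefl sigmoid_pos)
    then have "(\<integral>\<^sup>+x. ennreal (q x) \<partial>lborel) = 0"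
      by (subst nn_integral_0_iff_AE) auto
    with total show False by simp
  qed
  moreover have "0 \<le> reweighting_constant q F l"
    unfolding reweighting_constant_def
    using nonneg sigmoid_pos by (intro integral_nonneg_AE) (auto simp: less_imp_le)
  ultimately show ?thesis by simp
qed

lemma borel_measurable_cond_path_density [measurable (raw)]:
  fixes x0 x1 x :: "'a \<Rightarrow> real ^ 'd"
  assumes [measurable]: "t \<in> borel_measurable M" "x0 \<in> borel_measurable M"
    "x1 \<in> borel_measurable M" "x \<in> borel_measurable M"
  shows "(\<lambda>y. cond_path_density s (t y) (x0 y) (x1 y) (x y)) \<in> borel_measurable M"
  unfolding cond_path_density_def gaussian_density_def interp_path_def by measurable

text \<open>Turns joint measurability of a curried integrand into a rule that the measurability
  prover can use under nested integrals.\<close>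

lemma measurable_compose4:
  assumes g: "(\<lambda>(a, b, c, d). g a b c d) \<in> A \<Otimes>\<^sub>M B \<Otimes>\<^sub>M C \<Otimes>\<^sub>M D \<rightarrow>\<^sub>M N"
    and "a \<in> M \<rightarrow>\<^sub>M A" "b \<in> M \<rightarrow>\<^sub>M B" "c \<in> M \<rightarrow>\<^sub>M C" "d \<in> M \<rightarrow>\<^sub>M D"
  shows "(\<lambda>y. g (a y) (b y) (c y) (d y)) \<in> M \<rightarrow>\<^sub>M N"
proof -
  have "(\<lambda>y. (a y, b y, c y, d y)) \<in> M \<rightarrow>\<^sub>M A \<Otimes>\<^sub>M B \<Otimes>\<^sub>M C \<Otimes>\<^sub>M D"
    using assms by (intro measurable_Pair)
  from measurable_compose[OF this g] show ?thesis by simp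
qed

text \<open>\<open>ennreal (p x)\<close> is never infinite, which is the criterion for a density
  over a sigma-finite measure to be sigma-finite.\<close>

lemma sigma_finite_density_lborel:
  assumes "p \<in> borel_measurable borel"
  shows "sigma_finite_measure (density lborel (\<lambda>x. ennreal (p x)))"
  using assms by (subst sigma_finite_measure.sigma_finite_iff_density_finite[OF lborel.sigma_finite_measure_axioms]) auto

lemma AE_uniform_pair:
  assumes "sigma_finite_measure M"
  shows "AE y in uniform_measure lborel {0..1::real} \<Otimes>\<^sub>M M. fst y \<in> {0..1}"
proof -
  interpret U: prob_space "uniform_measure lborel {0..1::real}"
    by (rule prob_space_uniform_measure) auto
  interpret M: sigma_finite_measure M by fact
  interpret pair_sigma_finite "uniform_measure lborel {0..1::real}" M ..
  have "AE t in uniform_measure lborel {0..1::real}. t \<in> {0..1}"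
    by (rule AE_uniform_measureI) auto
  then show ?thesis
    by (intro AE_pair_measure) (measurable, elim eventually_mono, simp)
qed

text \<open>The law of \<open>t\<close> is carried by \<open>[0,1]\<close>, so values of the
  integrand at other times do not matter. This permits replacing a field that is measurable only
  over \<open>[0,1]\<close> by a globally measurable extension.\<close>

lemma flow_expectation_cong:
  fixes p0 p1 :: "real ^ 'd \<Rightarrow> real"
  assumes [measurable]: "p0 \<in> borel_measurable borel" "p1 \<in> borel_measurable borel"
    and "\<And>t x0 x1 x. t \<in> {0..1} \<Longrightarrow> g t x0 x1 x = g' t x0 x1 x"
  shows "flow_expectation s p0 p1 g = flow_expectation s p0 p1 g'"
proof -
  interpret P0: sigma_finite_measure "density lborel (\<lambda>x. ennreal (p0 x))"
    by (rule sigma_finite_density_lborel) measurable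
  interpret P1: sigma_finite_measure "density lborel (\<lambda>x. ennreal (p1 x))"
    by (rule sigma_finite_density_lborel) measurable
  interpret P: pair_sigma_finite "density lborel (\<lambda>x. ennreal (p0 x))"
    "density lborel (\<lambda>x. ennreal (p1 x))" ..
  show ?thesis
    unfolding flow_expectation_def
    using AE_uniform_pair[OF P.sigma_finite_measure_axioms]
    by (intro nn_integral_cong_AE, elim eventually_mono) (clarsimp simp: assms(3))
qed

text \<open>Moves all densities from the measures into the integrand. Expectations for different
  \<open>p1\<close> then live over one reference measure and can be compared pointwise.\<close>

lemma flow_expectation_eq:
  fixes p0 p1 :: "real ^ 'd \<Rightarrow> real"
  assumes [measurable]: "p0 \<in> borel_measurable borel" "p1 \<in> borel_measurable borel"
    and g: "(\<lambda>(t, x0, x1, x). g t x0 x1 x) \<in>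
      borel_measurable (borel \<Otimes>\<^sub>M borel \<Otimes>\<^sub>M borel \<Otimes>\<^sub>M borel)"
  shows "flow_expectation s p0 p1 g =
    (\<integral>\<^sup>+(t, x0, x1). ennreal (p0 x0) * ennreal (p1 x1) *
        (\<integral>\<^sup>+x. ennreal (cond_path_density s t x0 x1 x) * ennreal (g t x0 x1 x) \<partial>lborel)
      \<partial>(uniform_measure lborel {0..1} \<Otimes>\<^sub>M (lborel \<Otimes>\<^sub>M lborel)))"
proof -
  note [measurable (raw)] = measurable_compose4[OF g]
  let ?U = "uniform_measure lborel {0..1::real}"
  let ?P0 = "density lborel (\<lambda>x. ennreal (p0 x))"
  let ?P1 = "density lborel (\<lambda>x. ennreal (p1 x))"
  interpret P0: sigma_finite_measure ?P0
    by (rule sigma_finite_density_lborel) measurable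
  interpret P1: sigma_finite_measure ?P1
    by (rule sigma_finite_density_lborel) measurable
  interpret P: pair_sigma_finite ?P0 ?P1 ..
  have L: "sigma_finite_measure ((lborel :: (real ^ 'd) measure) \<Otimes>\<^sub>M (lborel :: (real ^ 'd) measure))"
    unfolding lborel_prod by (rule lborel.sigma_finite_measure_axioms)
  have eq1: "?P0 \<Otimes>\<^sub>M ?P1 =
      density (lborel \<Otimes>\<^sub>M lborel) (\<lambda>(x0, x1). ennreal (p0 x0) * ennreal (p1 x1))"
    by (rule pair_measure_density)
      (auto intro: P1.sigma_finite_measure_axioms lborel.sigma_finite_measure_axioms)
  \<comment> \<open>The product rule expects a density on both factors, so the uniform law is given
    the constant density 1.\<close>
  have "density ?U (\<lambda>_. 1) \<Otimes>\<^sub>M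
        density (lborel \<Otimes>\<^sub>M lborel) (\<lambda>(x0, x1). ennreal (p0 x0) * ennreal (p1 x1)) =
      density (?U \<Otimes>\<^sub>M (lborel \<Otimes>\<^sub>M lborel))
        (\<lambda>(t, y). 1 * (case y of (x0, x1) \<Rightarrow> ennreal (p0 x0) * ennreal (p1 x1)))"
    by (rule pair_measure_density)
      (auto simp: eq1[symmetric] intro: P.sigma_finite_measure_axioms L)
  then have eq2: "?U \<Otimes>\<^sub>M (?P0 \<Otimes>\<^sub>M ?P1) = density (?U \<Otimes>\<^sub>M (lborel \<Otimes>\<^sub>M lborel))
      (\<lambda>(t, x0, x1). ennreal (p0 x0) * ennreal (p1 x1))"
    by (simp add: eq1 density_1)
  have inner: "(\<integral>\<^sup>+x. ennreal (g t x0 x1 x)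
         \<partial>density lborel (\<lambda>x. ennreal (cond_path_density s t x0 x1 x))) =
      (\<integral>\<^sup>+x. ennreal (cond_path_density s t x0 x1 x) * ennreal (g t x0 x1 x) \<partial>lborel)"
    for t x0 x1
    by (rule nn_integral_density) measurable
  have [measurable_cong]: "sets ?U = sets borel" by simp
  show ?thesis
    unfolding flow_expectation_def eq2 inner
    by (subst nn_integral_density) (simp_all add: case_prod_unfold)
qed

text \<open>The weight depends on \<open>x1\<close> alone, so it is constant for the inner integral
  over \<open>x\<close>; once pulled out, it meets the factor \<open>p1 x1\<close>, and their
  product is \<open>c * p2 x1\<close>.\<close>

lemma flow_expectation_reweight:
  fixes p0 p1 p2 w :: "real ^ 'd \<Rightarrow> real"
  assumes [measurable]: "p0 \<in> borel_measurable borel" "p1 \<in> borel_measurable borel"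
      "p2 \<in> borel_measurable borel" "w \<in> borel_measurable borel"
    and g: "(\<lambda>(t, x0, x1, x). g t x0 x1 x) \<in>
      borel_measurable (borel \<Otimes>\<^sub>M borel \<Otimes>\<^sub>M borel \<Otimes>\<^sub>M borel)"
    and nonneg: "\<And>x. 0 \<le> p1 x" "\<And>x. 0 \<le> w x" "0 \<le> c"
    and eq: "\<And>x. p1 x * w x = c * p2 x"
  shows "flow_expectation s p0 p1 (\<lambda>t x0 x1 x. w x1 * g t x0 x1 x) =
    ennreal c * flow_expectation s p0 p2 g"
proof -
  note [measurable (raw)] = measurable_compose4[OF g]
  let ?U = "uniform_measure lborel {0..1::real}"
  let ?h = "\<lambda>t x0 x1. \<integral>\<^sup>+x. ennreal (cond_path_density s t x0 x1 x) * ennreal (g t x0 x1 x) \<partial>lborel"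
  have [measurable_cong]: "sets ?U = sets borel" by simp
  have pull: "(\<integral>\<^sup>+x. ennreal (cond_path_density s t x0 x1 x) * ennreal (w x1 * g t x0 x1 x) \<partial>lborel) =
      ennreal (w x1) * ?h t x0 x1" for t x0 x1
    by (subst nn_integral_cmult[symmetric]) (auto simp: ennreal_mult' nonneg mult_ac)
  \<comment> \<open>\<open>ennreal_mult'\<close> asks for a nonnegative left factor only:
    \<open>p1 x\<close> on one side, \<open>c\<close> on the other.\<close>
  have weight: "ennreal (p1 x) * ennreal (w x) = ennreal c * ennreal (p2 x)" for x
    using eq[of x] nonneg by (metis ennreal_mult')
  have "flow_expectation s p0 p1 (\<lambda>t x0 x1 x. w x1 * g t x0 x1 x) =
      (\<integral>\<^sup>+(t, x0, x1). ennreal (p0 x0) * ennreal (p1 x1) * (ennreal (w x1) * ?h t x0 x1)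
        \<partial>(?U \<Otimes>\<^sub>M (lborel \<Otimes>\<^sub>M lborel)))"
    by (subst flow_expectation_eq) (simp_all add: pull)
  also have "\<dots> = (\<integral>\<^sup>+y. ennreal c *
        (case y of (t, x0, x1) \<Rightarrow> ennreal (p0 x0) * ennreal (p2 x1) * ?h t x0 x1)
        \<partial>(?U \<Otimes>\<^sub>M (lborel \<Otimes>\<^sub>M lborel)))"
  proof (rule nn_integral_cong, clarify)
    fix t x0 x1
    have "ennreal (p0 x0) * ennreal (p1 x1) * (ennreal (w x1) * ?h t x0 x1) =
        ennreal (p0 x0) * (ennreal (p1 x1) * ennreal (w x1)) * ?h t x0 x1"
      by (simp only: mult_ac)
    also have "\<dots> = ennreal c * (ennreal (p0 x0) * ennreal (p2 x1) * ?h t x0 x1)"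
      unfolding weight by (simp only: mult_ac)
    finally show "ennreal (p0 x0) * ennreal (p1 x1) * (ennreal (w x1) * ?h t x0 x1) =
        ennreal c * (ennreal (p0 x0) * ennreal (p2 x1) * ?h t x0 x1)" .
  qed
  also have "\<dots> = ennreal c * flow_expectation s p0 p2 g"
    by (subst nn_integral_cmult) (measurable, simp add: flow_expectation_eq)
  finally show ?thesis .
qed

text \<open>The equation is between extended nonnegative reals, so it also covers parameters at
  which the losses diverge.\<close>

lemma erfm_loss_eq_cfm_loss:
  fixes q0 F :: "real ^ 'd \<Rightarrow> real"
  assumes q0: "prob_density q0" and [measurable]: "F \<in> borel_measurable borel"
    and v: "(\<lambda>(t, x). v \<theta> t x) \<in> borel_measurable (restrict_space borel ({0..1} \<times> UNIV))"
  shows "erfm_loss s v q0 F l \<theta> =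
    ennreal (reweighting_constant q0 F l) * cfm_loss s v q0 (reweighted_density q0 F l) \<theta>"
proof -
  let ?Z = "reweighting_constant q0 F l"
  have [measurable]: "q0 \<in> borel_measurable borel" and nonneg: "\<And>x. 0 \<le> q0 x"
    using q0 by (auto simp: prob_density_def)
  have Z: "0 < ?Z" using q0 by (rule reweighting_constant_pos) measurable
  have [measurable]: "reweighted_density q0 F l \<in> borel_measurable borel"
    unfolding reweighted_density_def[abs_def] by measurable
  \<comment> \<open>Measurability of the field is only available on \<open>[0,1]\<close>, so extend it by zero.\<close>
  define v' where "v' t x = indicator {0..1} t *\<^sub>R v \<theta> t x" for t x
  have "(\<lambda>y. indicator ({0..1} \<times> UNIV) y *\<^sub>R (case y of (t, x) \<Rightarrow> v \<theta> t x)) \<in> borel_measurable borel"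
    using v by (subst (asm) borel_measurable_restrict_space_iff) (auto intro!: borel_closed closed_Times)
  also have "(\<lambda>y. indicator ({0..1} \<times> UNIV) y *\<^sub>R (case y of (t, x) \<Rightarrow> v \<theta> t x)) = (\<lambda>(t, x). v' t x)"
    by (auto simp: v'_def fun_eq_iff indicator_def)
  finally have [measurable]: "(\<lambda>(t, x). v' t x) \<in> borel_measurable (borel \<Otimes>\<^sub>M borel)"
    by (simp add: borel_prod)
  have "erfm_loss s v q0 F l \<theta> = flow_expectation s q0 q0
      (\<lambda>t x0 x1 x. sigmoid (- l * F x1) * (norm (v' t x - target_velocity t x0 x1 x))\<^sup>2)"
    unfolding erfm_loss_def by (rule flow_expectation_cong) (auto simp: v'_def)
  \<comment> \<open>Reweighting with \<open>w x = sigmoid (- l * F x)\<close> and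
    \<open>c = ?Z\<close>. The required identity cancels \<open>?Z\<close> against the factor
    \<open>1 / ?Z\<close> in \<open>reweighted_density\<close>, which uses
    \<open>?Z > 0\<close>.\<close>
  also have "\<dots> = ennreal ?Z * flow_expectation s q0 (reweighted_density q0 F l)
      (\<lambda>t x0 x1 x. (norm (v' t x - target_velocity t x0 x1 x))\<^sup>2)"
    using Z nonneg unfolding target_velocity_def
    by (intro flow_expectation_reweight)
      (measurable, auto simp: reweighted_density_def less_imp_le sigmoid_pos)
  also have "flow_expectation s q0 (reweighted_density q0 F l)
      (\<lambda>t x0 x1 x. (norm (v' t x - target_velocity t x0 x1 x))\<^sup>2) =
      cfm_loss s v q0 (reweighted_density q0 F l) \<theta>"
    unfolding cfm_loss_def by (rule flow_expectation_cong) (auto simp: v'_def)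
  finally show ?thesis .
qed

theorem theorem4p1:
  fixes q0 qf F :: "real ^ 'd \<Rightarrow> real"
    and s l :: real
    and v :: "'p::euclidean_space \<Rightarrow> real \<Rightarrow> real ^ 'd \<Rightarrow> real ^ 'd"
  assumes "s > 0"
    and "prob_density q0"
    and "prob_density qf"
    and "energy_function F qf"
    and "l > 0"
    and "\<And>\<theta>. (\<lambda>(t, x). v \<theta> t x) \<in> borel_measurable (restrict_space borel ({0..1} \<times> UNIV))"
  shows "\<exists>C>0. \<forall>\<theta>.
     erfm_loss s v q0 F l \<theta> < \<infinity> \<and>
     cfm_loss s v q0 (reweighted_density q0 F l) \<theta> < \<infinity> \<and>
     (\<lambda>\<theta>'. enn2real (erfm_loss s v q0 F l \<theta>')) differentiable (at \<theta>) \<and>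
     (\<lambda>\<theta>'. enn2real (cfm_loss s v q0 (reweighted_density q0 F l) \<theta>')) differentiable (at \<theta>) \<longrightarrow>
     gradient (\<lambda>\<theta>'. enn2real (erfm_loss s v q0 F l \<theta>')) \<theta> =
     C *\<^sub>R gradient (\<lambda>\<theta>'. enn2real (cfm_loss s v q0 (reweighted_density q0 F l) \<theta>')) \<theta>"
proof -
  have F: "F \<in> borel_measurable borel"
    using assms(4) by (simp add: energy_function_def)
  have Z: "0 < reweighting_constant q0 F l"
    using assms(2) F by (rule reweighting_constant_pos)
  \<comment> \<open>This holds at every parameter: where the CFM loss is infinite, so is the ERFM
    loss because \<open>Z > 0\<close>, and \<open>enn2real\<close> sends both to 0. The real-valued
    losses are thus proportional as functions, as needed to compare derivatives.\<close>
  have "enn2real (erfm_loss s v q0 F l \<theta>) = reweighting_constant q0 F l *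
      enn2real (cfm_loss s v q0 (reweighted_density q0 F l) \<theta>)" for \<theta>
    using erfm_loss_eq_cfm_loss[where v = v, OF assms(2) F assms(6)] Z by (simp add: enn2real_mult)
  with Z gradient_cmult show ?thesis by auto
qed

end
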